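(* Let $\gamma>1$, $J>0$, $S_0>0$ and $\bar\rho_I>0$ be constants, put $\bar u_I=J/\bar\rho_I$ and $u_s=(\gamma S_0J^{\gamma-1})^{1/(\gamma+1)}$, and assume $\zeta_0:=\bar u_I/u_s>1$. Then for any $(u_0,E_0)\in\mathcal T_{\rm acc}$ with $u_0<u_s$ there exists a finite constant $l_{\max}>0$, depending only on $(\gamma,J,S_0,\bar u_I,u_0)$, such that the initial value problem $$\begin{cases}\bar u_1'=\dfrac{\bar E\,\bar u_1^\gamma}{\bar u_1^{\gamma+1}-u_s^{\gamma+1}},\\[1ex]\bar E'=\dfrac{J}{\bar u_1}-\bar\rho_I\end{cases}\text{ for }x_1>0,\qquad(\bar u_1,\bar E)(0)=(u_0,E_0)$$ has a unique smooth solution for $x_1\in[0,l_{\max})$, and it satisfies: (i) $\bar u_1'(x_1)>0$ on $[0,l_{\max})$; (ii) $\lim_{x_1\to l_{\max}-}\bar u_1'(x_1)=0$; (iii) $\mathcal T_{\rm acc}\cap\{(\bar u_1,\bar E)(x_1):0\le x_1\le l_{\max}\}=\mathcal T_{\rm acc}\cap\{(u,E):u\ge u_0\}$; (iv) there is a unique constant $l_s\in(0,l_{\max})$, depending only on $(\gamma,J,S_0,\bar u_I,u_0)$, such that $\bar u_1(x_1)<u_s$ for $x_1<l_s$, $\bar u_1(l_s)=u_s$, and $\bar u_1(x_1)>u_s$ for $x_1>l_s$.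
   Context: Define, for $u>0$, $$H(u)=\int_{u_s}^u\frac{J}{\bar u_It^{\gamma+1}}(t^{\gamma+1}-u_s^{\gamma+1})(\bar u_I-t)\,dt,$$ and $$\mathcal T_{\rm acc}=\{(u,E)\in(0,\infty)\times\mathbb{R}:\ \tfrac12E^2-H(u)=0,\ (u-u_s)E\ge0\}.$$ At a point where $\bar u_1=u_s$ the first differential equation is singular (of the form $0/0$); a smooth solution is a pair of smooth functions satisfying the equations wherever $\bar u_1\ne u_s$ (equivalently, satisfying $(\bar u_1^{\gamma+1}-u_s^{\gamma+1})\bar u_1'=\bar E\,\bar u_1^\gamma$ everywhere, with $\bar E=0$ where $\bar u_1=u_s$). Values at $x_1=l_{\max}$ are understood as limits. *)

theory Defs
  imports "HOL-Analysis.Analysis"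
begin

definition sonic_speed :: "real \<Rightarrow> real \<Rightarrow> real \<Rightarrow> real" where
  "sonic_speed \<gamma> J S\<^sub>0 = (\<gamma> * S\<^sub>0 * J powr (\<gamma> - 1)) powr (1 / (\<gamma> + 1))"

text \<open>
  The integral is oriented: for \<open>u < u\<^sub>s\<close> it is minus the integral over \<open>[u, u\<^sub>s]\<close>.
\<close>

definition H_fun :: "real \<Rightarrow> real \<Rightarrow> real \<Rightarrow> real \<Rightarrow> real \<Rightarrow> real" where
  "H_fun \<gamma> J u\<^sub>s u\<^sub>I u =
     (LBINT t=ereal u\<^sub>s..ereal u.
        J / (u\<^sub>I * t powr (\<gamma> + 1)) * (t powr (\<gamma> + 1) - u\<^sub>s powr (\<gamma> + 1)) * (u\<^sub>I - t))"

definition T_acc :: "real \<Rightarrow> real \<Rightarrow> real \<Rightarrow> real \<Rightarrow> (real \<times> real) set" where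
  "T_acc \<gamma> J u\<^sub>s u\<^sub>I =
     {(u, E). u > 0 \<and> (1/2) * E\<^sup>2 - H_fun \<gamma> J u\<^sub>s u\<^sub>I u = 0 \<and> (u - u\<^sub>s) * E \<ge> 0}"

text \<open>
  \<open>C\<^sup>\<infinity>\<close> on \<open>S\<close>: \<open>D n\<close> is the \<open>n\<close>-th derivative. Derivatives are taken within \<open>S\<close>, hence
  one-sided at the endpoint \<open>0\<close> of \<open>[0, l)\<close>.
\<close>

definition smooth_on :: "real set \<Rightarrow> (real \<Rightarrow> real) \<Rightarrow> bool" where
  "smooth_on S f \<longleftrightarrow>
     (\<exists>D :: nat \<Rightarrow> real \<Rightarrow> real. D 0 = f \<and>
        (\<forall>n. \<forall>x\<in>S. (D n has_real_derivative D (Suc n) x) (at x within S)))"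

text \<open>
  Where \<open>u \<noteq> u\<^sub>s\<close> the first equation is required as it stands; where \<open>u = u\<^sub>s\<close> it is of the form
  \<open>0/0\<close> and is replaced by \<open>E = 0\<close>. Pointwise this is the regularised equation
  \<open>(u\<^bsup>\<gamma>+1\<^esup> - u\<^sub>s\<^bsup>\<gamma>+1\<^esup>) u' = E u\<^bsup>\<gamma>\<^esup>\<close>. The state space is \<open>u > 0\<close>, as in \<open>T_acc\<close>.
\<close>

definition smooth_solution ::
  "real \<Rightarrow> real \<Rightarrow> real \<Rightarrow> real \<Rightarrow> real \<Rightarrow> real \<Rightarrow> real \<Rightarrow> (real \<Rightarrow> real) \<Rightarrow> (real \<Rightarrow> real) \<Rightarrow> bool"
where
  "smooth_solution \<gamma> J u\<^sub>s \<rho>\<^sub>I u\<^sub>0 E\<^sub>0 l u E \<longleftrightarrow>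
     smooth_on {0..<l} u \<and> smooth_on {0..<l} E \<and> (\<forall>x\<in>{0..<l}. u x > 0) \<and>
     u 0 = u\<^sub>0 \<and> E 0 = E\<^sub>0 \<and>
     (\<forall>x\<in>{0<..<l}.
        (u x \<noteq> u\<^sub>s \<longrightarrow>
           (u has_real_derivative
              E x * u x powr \<gamma> / (u x powr (\<gamma> + 1) - u\<^sub>s powr (\<gamma> + 1))) (at x)) \<and>
        (u x = u\<^sub>s \<longrightarrow> E x = 0) \<and>
        (E has_real_derivative J / u x - \<rho>\<^sub>I) (at x))"

definition sonic_crossing :: "real \<Rightarrow> real \<Rightarrow> (real \<Rightarrow> real) \<Rightarrow> real \<Rightarrow> bool" where
  "sonic_crossing u\<^sub>s l u c \<longleftrightarrow>
     c \<in> {0<..<l} \<and> (\<forall>x\<in>{0..<c}. u x < u\<^sub>s) \<and> u c = u\<^sub>s \<and> (\<forall>x\<in>{c<..<l}. u x > u\<^sub>s)"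

end

theory Submission
  imports Defs "HOL-Complex_Analysis.Complex_Analysis"
begin

text \<open>
  The energy \<open>E\<^sup>2/2 - H(u)\<close> is conserved, so a solution starting in \<open>T_acc\<close> satisfies \<open>E\<^sup>2 = 2 H(u)\<close>.
  Both \<open>H\<close> and \<open>u\<^bsup>\<gamma>+1\<^esup> - u\<^sub>s\<^bsup>\<gamma>+1\<^esup>\<close> extend holomorphically to the right half-plane; dividing out their zeros
  at \<open>u\<^sub>s\<close>, \<open>H = (u - u\<^sub>s)\<^sup>2 K\<close> and \<open>u\<^bsup>\<gamma>+1\<^esup> - u\<^sub>s\<^bsup>\<gamma>+1\<^esup> = (u - u\<^sub>s) Q\<close> with \<open>K, Q > 0\<close>, turns the branch of \<open>T_acc\<close>
  into \<open>E = (u - u\<^sub>s) \<surd>(2K)\<close> and the system into the regular autonomous equation \<open>u' = V(u)\<close>,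
  \<open>V = \<surd>(2K) u\<^sup>\<gamma> / Q\<close>, on \<open>(0, u\<^sub>m\<^sub>a\<^sub>x)\<close>, where \<open>u\<^sub>m\<^sub>a\<^sub>x > u\<^sub>I\<close> is the second zero of \<open>H\<close>.
  The life span is finite because \<open>E' = J/u - \<rho>\<^sub>I\<close> is bounded away from \<open>0\<close> near \<open>u\<^sub>m\<^sub>a\<^sub>x\<close>
  while \<open>E\<close> has to stay nonnegative.
  The equations and the initial value alone do not force acceleration beyond the sonic point;
  there, differentiability of \<open>u\<close> selects the branch.
\<close>

section \<open>General tools: division by a linear factor, analytic flows, autonomous
  equations\<close>

text \<open>The difference quotient has a removable singularity at \<open>a\<close>, filled by
  \<open>deriv f a\<close>. Dividing out the zeros at the sonic point in this way leaves functions
  that are analytic there as well, which is where smoothness across that point comes from.\<close>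

lemma holomorphic_factor_linear:
  assumes "f holomorphic_on S" "open S"
  obtains g where "g holomorphic_on S" "\<And>z. f z = f a + (z - a) * g z" "g a = deriv f a"
proof
  show "(\<lambda>z. if z = a then deriv f a else (f z - f a) / (z - a)) holomorphic_on S"
    using assms by (rule pole_lemma_open)
qed auto

text \<open>If \<open>u' = V u\<close>, then the \<open>n\<close>-th derivative of \<open>f \<circ> u\<close> is \<open>W\<^sub>n \<circ> u\<close> with \<open>W\<^sub>0 = f\<close> and
  \<open>W\<^sub>n\<^sub>+\<^sub>1 = W\<^sub>n' V\<close>.\<close>

lemma smooth_on_analytic_flow:
  fixes u V :: "real \<Rightarrow> real" and f Vc :: "complex \<Rightarrow> complex"
  assumes f: "f analytic_on complex_of_real ` I" and Vc: "Vc analytic_on complex_of_real ` I"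
    and V: "\<And>w. w \<in> I \<Longrightarrow> Vc (of_real w) = of_real (V w)"
    and u: "\<And>x. x \<in> S \<Longrightarrow> u x \<in> I"
    and du: "\<And>x. x \<in> S \<Longrightarrow> (u has_real_derivative V (u x)) (at x within S)"
  shows "smooth_on S (\<lambda>x. Re (f (of_real (u x))))"
proof -
  define W where "W n = ((\<lambda>g z. deriv g z * Vc z) ^^ n) f" for n
  have W0: "W 0 = f" and WS: "W (Suc n) = (\<lambda>z. deriv (W n) z * Vc z)" for n
    by (auto simp: W_def)
  have an: "W n analytic_on complex_of_real ` I" for n
    by (induction n) (auto simp: W0 WS f Vc intro!: analytic_intros)
  have "((\<lambda>x. Re (W n (of_real (u x)))) has_real_derivative Re (W (Suc n) (of_real (u x)))) (at x within S)"
    if x: "x \<in> S" for n x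
  proof -
    have "W n analytic_on {of_real (u x)}"
      using an u[OF x] analytic_on_subset by blast
    then have "(W n has_field_derivative deriv (W n) (of_real (u x))) (at (of_real (u x)))"
      using analytic_on_imp_differentiable_at field_differentiable_derivI by blast
    moreover have "((\<lambda>x. complex_of_real (u x)) has_vector_derivative of_real (V (u x))) (at x within S)"
      using du[OF x] by (intro has_vector_derivative_of_real)
        (simp add: has_real_derivative_iff_has_vector_derivative)
    ultimately have "((W n \<circ> (\<lambda>x. complex_of_real (u x))) has_vector_derivative
        of_real (V (u x)) * deriv (W n) (of_real (u x))) (at x within S)"
      using field_vector_diff_chain_within has_field_derivative_at_within by blast
    then have "((\<lambda>x. W n (of_real (u x))) has_vector_derivative W (Suc n) (of_real (u x))) (at x within S)"
      using V[OF u[OF x]] by (simp add: WS o_def mult.commute)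
    then show ?thesis
      by (rule has_field_derivative_Re)
  qed
  then show ?thesis
    unfolding smooth_on_def by (intro exI[of _ "\<lambda>n x. Re (W n (of_real (u x)))"]) (auto simp: W0)
qed

text \<open>\<open>G\<close> is the time needed to reach a given state, so that the solution is its inverse and the
  life span is its supremum.\<close>

lemma autonomous_solution:
  fixes V G :: "real \<Rightarrow> real"
  assumes u0: "u0 \<in> {a<..<b}" and V: "\<And>w. w \<in> {a<..<b} \<Longrightarrow> V w > 0"
    and G: "\<And>w. w \<in> {a<..<b} \<Longrightarrow> (G has_real_derivative inverse (V w)) (at w)"
    and G0: "G u0 = 0" and bdd: "bdd_above (G ` {u0..<b})"
  obtains l u where "l > 0" "\<And>w. w \<in> {a<..<b} \<Longrightarrow> u (G w) = w"
    "\<And>x. x \<in> {0..<l} \<Longrightarrow> G (u x) = x"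
    "u ` {0..<l} = {u0..<b}" "strict_mono_on {0..<l} u"
    "\<And>x. x \<in> {0..<l} \<Longrightarrow> (u has_real_derivative V (u x)) (at x)"
    "(u \<longlongrightarrow> b) (at_left l)"
proof -
  define l where "l = Sup (G ` {u0..<b})"
  define u where "u = inv_into {a<..<b} G"
  have contG: "continuous_on {a<..<b} G"
    using G DERIV_isCont continuous_at_imp_continuous_on by blast
  have mono: "G w < G z" if "w \<in> {a<..<b}" "z \<in> {a<..<b}" "w < z" for w z
  proof (rule DERIV_pos_imp_increasing[OF \<open>w < z\<close>])
    fix x assume "w \<le> x" "x \<le> z"
    then have "x \<in> {a<..<b}" using that by auto
    then show "\<exists>y. (G has_real_derivative y) (at x) \<and> y > 0"
      using G V by (meson positive_imp_inverse_positive)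
  qed
  then have "inj_on G {a<..<b}"
    by (metis linorder_inj_onI' less_irrefl)
  then have uG: "u (G w) = w" if "w \<in> {a<..<b}" for w
    using that by (simp add: u_def)
  have range: "G w \<in> {0..<l}" if w: "w \<in> {u0..<b}" for w
  proof -
    \<comment> \<open>A further state \<open>z\<close> makes \<open>G w < l\<close> strict: the
      supremum is not attained, so the time interval is half-open.\<close>
    obtain z where z: "w < z" "z < b" using w dense by auto
    have "G w < G z" using mono z w u0 by auto
    also have "G z \<le> l" unfolding l_def using z w by (intro cSup_upper bdd) auto
    moreover have "G u0 \<le> G w" using mono[of u0 w] w u0 by (cases "w = u0") auto
    ultimately show ?thesis using G0 by auto
  qed
  have ex: "\<exists>w\<in>{u0..<b}. G w = x" if x: "x \<in> {0..<l}" for x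
  proof -
    obtain z where z: "z \<in> {u0..<b}" "x < G z"
      using x less_cSup_iff[of "G ` {u0..<b}" x] bdd u0 unfolding l_def by auto
    have "\<exists>w\<ge>u0. w \<le> z \<and> G w = x"
      using z x G0 u0 by (intro IVT' continuous_on_subset[OF contG]) auto
    then show ?thesis using z by auto
  qed
  show ?thesis
  proof
    show "l > 0" using range[of u0] u0 G0 by auto
    show "u (G w) = w" if "w \<in> {a<..<b}" for w by (rule uG[OF that])
    show Gu: "G (u x) = x" if "x \<in> {0..<l}" for x
      using ex[OF that] uG u0 by force
    show im: "u ` {0..<l} = {u0..<b}"
    proof
      show "u ` {0..<l} \<subseteq> {u0..<b}" using ex uG u0 by force
      show "{u0..<b} \<subseteq> u ` {0..<l}"
      proof
        fix w assume w: "w \<in> {u0..<b}"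
        then have "u (G w) = w" using uG u0 by auto
        then show "w \<in> u ` {0..<l}" using range[OF w] by (metis image_eqI)
      qed
    qed
    show "strict_mono_on {0..<l} u"
    proof (rule strict_mono_onI)
      fix x y assume xy: "x \<in> {0..<l}" "y \<in> {0..<l}" "x < y"
      then have "u x \<in> {u0..<b}" "u y \<in> {u0..<b}" using im by auto
      then show "u x < u y"
        using xy mono[of "u y" "u x"] Gu[of x] Gu[of y] u0 by (cases "u x" "u y" rule: linorder_cases) auto
    qed
    show "(u has_real_derivative V (u x)) (at x)" if x: "x \<in> {0..<l}" for x
    proof -
      have "u x \<in> {u0..<b}" using im x by blast
      then have ux: "u x \<in> {a<..<b}" using u0 by auto
      \<comment> \<open>The inverse function theorem is applied on the whole open interval, of which
        \<open>u0\<close> is an interior point; hence the derivative is two-sided even at time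
        0.\<close>
      have "(u has_real_derivative inverse (inverse (V (u x)))) (at (G (u x)))"
        by (rule has_field_derivative_inverse_strong[where S = "{a<..<b}"])
          (use G[OF ux] V[OF ux] ux contG uG in auto)
      then show ?thesis using Gu[OF x] by simp
    qed
    show "(u \<longlongrightarrow> b) (at_left l)"
    proof (rule order_tendstoI)
      fix y assume "y < b"
      define w where "w = max y u0"
      have w: "w \<in> {u0..<b}" "y \<le> w" using \<open>y < b\<close> u0 by (auto simp: w_def)
      have "\<forall>\<^sub>F x in at_left l. x \<in> {G w<..<l}"
        using range[OF w(1)] by (intro eventually_at_leftI[of "G w"]) auto
      then show "\<forall>\<^sub>F x in at_left l. y < u x"
      proof eventually_elim
        case (elim x)
        then have x: "x \<in> {0..<l}" using range[OF w(1)] by auto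
        then obtain z where z: "z \<in> {u0..<b}" "G z = x" using ex by blast
        then have "w < z" using elim mono[of z w] w(1) u0 by (cases z w rule: linorder_cases) auto
        then show ?case using z w uG[of z] u0 by auto
      qed
    next
      fix y assume y: "b < y"
      have "\<forall>\<^sub>F x in at_left l. x \<in> {0<..<l}"
        using range[of u0] u0 G0 by (intro eventually_at_leftI[of 0]) auto
      then show "\<forall>\<^sub>F x in at_left l. u x < y"
      proof eventually_elim
        case (elim x)
        then have "u x \<in> {u0..<b}" using im by auto
        then show ?case using y by auto
      qed
    qed
  qed
qed

section \<open>The function \<open>H\<close>: closed form, monotonicity, second zero\<close>

locale accelerating_flow =
  fixes \<gamma> J us uI :: real
  assumes gamma: "\<gamma> > 1" and J: "J > 0" and us: "us > 0" and uI: "us < uI"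
begin

definition h :: "real \<Rightarrow> real" where
  "h t = J / (uI * t powr (\<gamma> + 1)) * (t powr (\<gamma> + 1) - us powr (\<gamma> + 1)) * (uI - t)"

text \<open>An antiderivative of \<open>h\<close>, found by expanding the product into powers of
  \<open>t\<close>. The exponents \<open>- \<gamma> - 1\<close> and \<open>- \<gamma>\<close> differ
  from -1 because \<open>\<gamma> > 1\<close>, so no logarithm occurs.\<close>

definition A :: "real \<Rightarrow> real" where
  "A t = J / uI * (uI * t - t\<^sup>2 / 2 + us powr (\<gamma> + 1) * uI / \<gamma> * t powr (- \<gamma>)
     - us powr (\<gamma> + 1) / (\<gamma> - 1) * t powr (1 - \<gamma>))"

abbreviation H :: "real \<Rightarrow> real" where
  "H \<equiv> H_fun \<gamma> J us uI"

lemma h_alt: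
  assumes "t > 0"
  shows "h t = J / uI * (1 - us powr (\<gamma> + 1) * t powr (- \<gamma> - 1)) * (uI - t)"
  using assms uI us by (simp add: h_def powr_minus_divide[of t "\<gamma> + 1", simplified] field_simps)

lemma A_deriv:
  assumes "t > 0"
  shows "(A has_real_derivative h t) (at t)"
proof -
  have e: "t powr (-\<gamma>) = t * t powr (-\<gamma> - 1)"
    using assms powr_mult_base[of t "-\<gamma> - 1"] by simp
  \<comment> \<open>With variables as coefficients, the quotients by \<open>\<gamma>\<close> and
    \<open>\<gamma> - 1\<close> stay out of the differentiation and cancel on instantiation.\<close>
  have *: "((\<lambda>t. J / uI * (uI * t - t\<^sup>2 / 2 + a * t powr (- \<gamma>) - b * t powr (1 - \<gamma>))) has_real_derivative
      J / uI * (uI - t - a * \<gamma> * t powr (- \<gamma> - 1) + b * (\<gamma> - 1) * t powr (- \<gamma>))) (at t)" for a b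
    using assms by (intro DERIV_cmult) (auto intro!: derivative_eq_intros simp: algebra_simps)
  have "(A has_real_derivative J / uI * (uI - t - us powr (\<gamma> + 1) * uI * t powr (- \<gamma> - 1)
      + us powr (\<gamma> + 1) * t powr (- \<gamma>))) (at t)"
    using *[of "us powr (\<gamma> + 1) * uI / \<gamma>" "us powr (\<gamma> + 1) / (\<gamma> - 1)"] gamma
    unfolding A_def by simp
  also have "J / uI * (uI - t - us powr (\<gamma> + 1) * uI * t powr (- \<gamma> - 1)
      + us powr (\<gamma> + 1) * t powr (- \<gamma>)) = h t"
    unfolding h_alt[OF assms] e mult.assoc
    by (rule arg_cong[where f = "\<lambda>x. J / uI * x", unfolded mult.assoc]) (simp add: algebra_simps)
  finally show ?thesis .
qed

text \<open>The fundamental theorem for oriented integrals treats both orders of \<open>us\<close>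
  and \<open>u\<close> at once. The closed form gives access to the behaviour at infinity and to a
  holomorphic extension.\<close>

lemma H_eq:
  assumes "u > 0"
  shows "H u = A u - A us"
  unfolding H_fun_def
proof (rule interval_integral_FTC_finite)
  have pos: "x > 0" if "x \<in> {min us u..max us u}" for x
    using that assms us by auto
  show "continuous_on {min us u..max us u} (\<lambda>t. J / (uI * t powr (\<gamma> + 1)) *
      (t powr (\<gamma> + 1) - us powr (\<gamma> + 1)) * (uI - t))"
    using pos uI us by (intro continuous_intros) force+
  show "(A has_vector_derivative J / (uI * x powr (\<gamma> + 1)) *
      (x powr (\<gamma> + 1) - us powr (\<gamma> + 1)) * (uI - x)) (at x within {min us u..max us u})"
    if "min us u \<le> x" "x \<le> max us u" for x
    using A_deriv[of x] pos[of x] that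
    by (simp add: h_def has_real_derivative_iff_has_vector_derivative has_vector_derivative_at_within)
qed

lemma H_us [simp]: "H us = 0"
  using H_eq us by simp

lemma H_deriv:
  assumes "t > 0"
  shows "(H has_real_derivative h t) (at t)"
proof -
  have "((\<lambda>t. A t - A us) has_real_derivative h t) (at t)"
    using A_deriv[OF assms] by (auto intro!: derivative_eq_intros)
  then show ?thesis
    by (rule has_field_derivative_transform_within_open[where S = "{0<..}"]) (use assms H_eq in auto)
qed

lemma h_neg_left:
  assumes "0 < t" "t < us"
  shows "h t < 0"
proof -
  have "t powr (\<gamma> + 1) < us powr (\<gamma> + 1)"
    using assms gamma by (intro powr_less_mono2) auto
  then show ?thesis
    unfolding h_def using assms J uI by (intro mult_neg_pos mult_pos_neg) auto
qed

lemma h_sign_right: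
  assumes "us < t"
  shows "t < uI \<Longrightarrow> h t > 0" "uI < t \<Longrightarrow> h t < 0"
proof -
  have "us powr (\<gamma> + 1) < t powr (\<gamma> + 1)"
    using assms us gamma by (intro powr_less_mono2) auto
  then have "J / (uI * t powr (\<gamma> + 1)) * (t powr (\<gamma> + 1) - us powr (\<gamma> + 1)) > 0"
    using assms us J uI by (intro mult_pos_pos) auto
  then show "t < uI \<Longrightarrow> h t > 0" "uI < t \<Longrightarrow> h t < 0"
    unfolding h_def using mult_pos_pos mult_pos_neg by force+
qed

lemma H_continuous: "continuous_on {0<..} H"
  using H_deriv by (intro continuous_at_imp_continuous_on) (auto intro: DERIV_isCont)

lemma H_decreasing_left:
  assumes "0 < x" "x < y" "y \<le> us"
  shows "H y < H x"
proof (rule DERIV_neg_imp_decreasing_open[OF assms(2)])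
  show "\<exists>d. (H has_real_derivative d) (at t) \<and> d < 0" if "x < t" "t < y" for t
    using that assms H_deriv[of t] h_neg_left[of t] by auto
qed (use assms in \<open>auto intro: continuous_on_subset[OF H_continuous]\<close>)

lemma H_increasing:
  assumes "us \<le> x" "x < y" "y \<le> uI"
  shows "H x < H y"
proof (rule DERIV_pos_imp_increasing_open[OF assms(2)])
  show "\<exists>d. (H has_real_derivative d) (at t) \<and> d > 0" if "x < t" "t < y" for t
    using that assms us H_deriv[of t] h_sign_right[of t] by auto
qed (use assms us in \<open>auto intro: continuous_on_subset[OF H_continuous]\<close>)

lemma H_decreasing_right:
  assumes "uI \<le> x" "x < y"
  shows "H y < H x"
proof (rule DERIV_neg_imp_decreasing_open[OF assms(2)])
  show "\<exists>d. (H has_real_derivative d) (at t) \<and> d < 0" if "x < t" "t < y" for t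
    using that assms us uI H_deriv[of t] h_sign_right[of t] by auto
qed (use assms us uI in \<open>auto intro: continuous_on_subset[OF H_continuous]\<close>)

text \<open>The quadratic term of \<open>A\<close> dominates, since both powers with a real exponent
  tend to 0 for \<open>\<gamma> > 1\<close>.\<close>

lemma H_at_top: "filterlim H at_bot at_top"
proof -
  define s where "s = us powr (\<gamma> + 1)"
  have s: "s > 0" using us by (simp add: s_def)
  have *: "filterlim (\<lambda>u. A u - c) at_bot at_top" for c
    unfolding A_def s_def[symmetric] using gamma J us uI s by real_asymp
  have "\<forall>\<^sub>F u in at_top. A u - A us = H u"
    using eventually_gt_at_top[of 0] by eventually_elim (simp add: H_eq)
  from filterlim_cong[OF refl refl this, where ?F1.0 = at_bot] * show ?thesis by simp
qed

text \<open>\<open>H\<close> is positive at \<open>uI\<close>, having increased from 0 at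
  \<open>us\<close>, and negative far out; the intermediate value theorem does the rest.\<close>

lemma ex_umax:
  obtains um where "um > uI" "H um = 0"
proof -
  obtain w where w: "w > uI" "H w < 0"
    using eventually_conj[OF eventually_gt_at_top[of uI] filterlim_at_bot_dense[THEN iffD1, OF H_at_top, rule_format, of 0]]
    by (auto dest!: eventually_happens)
  have pos: "H uI > 0"
    using H_increasing[of us uI] uI by simp
  have "\<exists>x\<ge>uI. x \<le> w \<and> H x = 0"
    using w pos us uI
    by (intro IVT2') (auto intro!: continuous_at_imp_continuous_on DERIV_isCont H_deriv)
  then show ?thesis
    using that pos by (metis less_eq_real_def less_irrefl)
qed

text \<open>The velocity at which the branch returns to \<open>E = 0\<close>, and the end state of
  the solution. The choice is harmless: \<open>H\<close> is strictly decreasing beyond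
  \<open>uI\<close>, so it has only one zero there.\<close>

definition umax :: real where
  "umax = (SOME u. u > uI \<and> H u = 0)"

lemma umax: "umax > uI" "H umax = 0"
proof -
  have "umax > uI \<and> H umax = 0"
    unfolding umax_def by (rule someI_ex) (use ex_umax in blast)
  then show "umax > uI" "H umax = 0" by auto
qed

lemma H_pos:
  assumes "0 < u" "u < umax" "u \<noteq> us"
  shows "H u > 0"
proof (cases u uI rule: linorder_le_cases)
  case le
  then show ?thesis
    using H_decreasing_left[of u us] H_increasing[of us u] assms by (cases u us rule: linorder_cases) auto
next
  case ge
  then show ?thesis using H_decreasing_right[of u umax] assms umax by auto
qed

text \<open>Since \<open>E\<^sup>2 = 2 * H u\<close> on \<open>T_acc\<close>, this leaves no point
  of \<open>T_acc\<close> beyond \<open>umax\<close>.\<close>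

lemma H_neg: "umax < u \<Longrightarrow> H u < 0"
  using H_decreasing_right[of umax u] umax by auto

section \<open>Dividing out the zeros at the sonic point\<close>

text \<open>The zero of \<open>H\<close> at \<open>us\<close> is double because
  \<open>h us = 0\<close>, and that of the power difference is simple. The last identity comes from
  differentiating \<open>H x = (x - us)\<^sup>2 * k x\<close>, comparing with \<open>h\<close> and
  cancelling \<open>x - us\<close>; it yields both the positivity of \<open>k\<close> at
  \<open>us\<close> and the derivative of the branch.\<close>

lemma factorisation:
  obtains K Q :: "complex \<Rightarrow> complex" and k k' q :: "real \<Rightarrow> real"
  where "K holomorphic_on {z. Re z > 0}" "Q holomorphic_on {z. Re z > 0}"
    "\<And>x. x > 0 \<Longrightarrow> K (of_real x) = of_real (k x)" "\<And>x. x > 0 \<Longrightarrow> Q (of_real x) = of_real (q x)"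
    "\<And>x. x > 0 \<Longrightarrow> H x = (x - us)\<^sup>2 * k x"
    "\<And>x. x > 0 \<Longrightarrow> x powr (\<gamma> + 1) - us powr (\<gamma> + 1) = (x - us) * q x"
    "\<And>x. x > 0 \<Longrightarrow> q x > 0"
    "\<And>x. x > 0 \<Longrightarrow> (k has_real_derivative k' x) (at x)"
    "\<And>x. x > 0 \<Longrightarrow> 2 * k x + (x - us) * k' x = J / uI * x powr (- \<gamma> - 1) * (uI - x) * q x"
proof -
  let ?S = "{z. Re z > 0}"
  have S: "open ?S" by (rule open_halfspace_Re_gt)
  have nonpos: "z \<notin> \<real>\<^sub>\<le>\<^sub>0" if "z \<in> ?S" for z
    using that by (auto simp: complex_nonpos_Reals_iff)
  define s c\<^sub>1 c\<^sub>2 a b where "s = us powr (\<gamma> + 1)" and "c\<^sub>1 = s * uI / \<gamma>" and "c\<^sub>2 = s / (\<gamma> - 1)"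
    and "a = - \<gamma>" and "b = 1 - \<gamma>"
  have A: "A x = J / uI * (uI * x - x\<^sup>2 / 2 + c\<^sub>1 * x powr a - c\<^sub>2 * x powr b)" for x
    by (simp add: A_def s_def c\<^sub>1_def c\<^sub>2_def a_def b_def)
  define Hc :: "complex \<Rightarrow> complex" where
    "Hc z = of_real (J / uI) * (of_real uI * z - z\<^sup>2 / 2 + of_real c\<^sub>1 * z powr of_real a
     - of_real c\<^sub>2 * z powr of_real b) - of_real (A us)" for z
  define P :: "complex \<Rightarrow> complex" where "P z = z powr of_real (\<gamma> + 1)" for z
  have Hc: "Hc (of_real x) = of_real (H x)" if "x > 0" for x
    using that by (simp add: Hc_def A H_eq powr_of_real)
  have P: "P (of_real x) = of_real (x powr (\<gamma> + 1))" if "x > 0" for x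
    unfolding P_def using that by (intro powr_of_real) auto
  have holH: "Hc holomorphic_on ?S" and holP: "P holomorphic_on ?S"
    unfolding Hc_def P_def using nonpos by (auto intro!: holomorphic_intros)
  have real_deriv: "((\<lambda>x. Re (f (of_real x))) has_real_derivative Re (deriv f (of_real x))) (at x)"
    if "f holomorphic_on ?S" "x > 0" for f :: "complex \<Rightarrow> complex" and x :: real
  proof -
    have "(f has_field_derivative deriv f (of_real x)) (at (of_real x))"
      using that S by (intro holomorphic_derivI) auto
    then show ?thesis
      by (intro has_field_derivative_Re) (auto dest: has_vector_derivative_real_field)
  qed
  have deriv_real: "deriv f (of_real x) = of_real D"
    if "f holomorphic_on ?S" "x > 0" "\<And>y. y > 0 \<Longrightarrow> f (of_real y) = of_real (F y)"
      "(F has_real_derivative D) (at x)" for f :: "complex \<Rightarrow> complex" and x D F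
  proof -
    have "(f has_field_derivative deriv f (of_real x)) (at (of_real x))"
      using that S by (intro holomorphic_derivI) auto
    then have 1: "((\<lambda>y. f (of_real y)) has_vector_derivative deriv f (of_real x)) (at x)"
      by (rule has_vector_derivative_real_field)
    have "((\<lambda>y. complex_of_real (F y)) has_vector_derivative of_real D) (at x)"
      using that(4) by (intro has_vector_derivative_of_real)
        (simp add: has_real_derivative_iff_has_vector_derivative)
    then have "((\<lambda>y. f (of_real y)) has_vector_derivative of_real D) (at x)"
      by (rule has_vector_derivative_transform_within_open[where S = "{0<..}"]) (use that in auto)
    with 1 show ?thesis
      using vector_derivative_unique_at by blast
  qed
  \<comment> \<open>On the positive axis \<open>Hc\<close> is \<open>H\<close>, so its derivative at
    \<open>us\<close> is \<open>h us\<close>. As this vanishes, a second linear factor can be split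
    off.\<close>
  have "deriv Hc (of_real us) = of_real (h us)"
    using holH us Hc H_deriv by (intro deriv_real[where F = H]) auto
  then have dH: "deriv Hc (of_real us) = 0" by (simp add: h_def)
  obtain g where g: "g holomorphic_on ?S" "\<And>z. Hc z = Hc us + (z - us) * g z" "g us = deriv Hc us"
    using holomorphic_factor_linear[OF holH S] by metis
  obtain K where K: "K holomorphic_on ?S" "\<And>z. g z = g us + (z - us) * K z"
    using holomorphic_factor_linear[OF g(1) S] by metis
  obtain Q where Q: "Q holomorphic_on ?S" "\<And>z. P z = P us + (z - us) * Q z" "Q us = deriv P us"
    using holomorphic_factor_linear[OF holP S] by metis
  have HK: "Hc z = (z - us)\<^sup>2 * K z" for z
  proof -
    have "g us = 0" "Hc us = 0" using g(3) dH Hc[OF us] by auto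
    then show ?thesis
      unfolding g(2)[of z] K(2)[of z] by (simp add: power2_eq_square)
  qed
  define k where "k x = Re (K (of_real x))" for x
  define k' where "k' x = Re (deriv K (of_real x))" for x
  define q where "q x = Re (Q (of_real x))" for x
  have k': "(k has_real_derivative k' x) (at x)" if "x > 0" for x
    unfolding k_def k'_def by (rule real_deriv[OF K(1) that])
  have cont: "isCont (\<lambda>x. Re (f (complex_of_real x))) us" "isCont (\<lambda>x. Im (f (complex_of_real x))) us" if "f holomorphic_on ?S" for f :: "complex \<Rightarrow> complex"
  proof -
    have "isCont f (of_real us)"
      using holomorphic_on_imp_continuous_on[OF that] us
      unfolding continuous_on_eq_continuous_at[OF S] by simp
    then have "isCont (\<lambda>x. f (complex_of_real x)) us"
      by (rule isCont_o2[rotated]) (intro continuous_intros)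
    then show "isCont (\<lambda>x. Re (f (complex_of_real x))) us" "isCont (\<lambda>x. Im (f (complex_of_real x))) us"
      by (auto intro: continuous_Re continuous_Im)
  qed
  \<comment> \<open>Identities obtained by dividing by \<open>x - us\<close> are only known away
    from \<open>us\<close>; continuity carries them over.\<close>
  have zero: "F us = 0" if "isCont F us" "\<And>x. x > 0 \<Longrightarrow> x \<noteq> us \<Longrightarrow> F x = 0" for F :: "real \<Rightarrow> real"
  proof -
    have "\<forall>\<^sub>F x in at us. x \<in> {0<..} - {us}"
      using us by (intro eventually_at_in_open) auto
    then have "\<forall>\<^sub>F x in at us. F x = 0"
      by eventually_elim (use that(2) in auto)
    then have "(F \<longlongrightarrow> 0) (at us)"
      by (rule tendsto_eventually)
    with that(1) show ?thesis
      unfolding isCont_def by (rule LIM_unique)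
  qed
  have Kx: "K (of_real x) = of_real (H x / (x - us)\<^sup>2)" if "x > 0" "x \<noteq> us" for x
    using HK[of "of_real x"] Hc[OF that(1)] that by (simp add: field_simps)
  have "Im (K (of_real us)) = 0"
    by (rule zero[where F = "\<lambda>x. Im (K (of_real x))"]) (use cont(2)[OF K(1)] Kx in auto)
  then have Kk: "K (of_real x) = of_real (k x)" if "x > 0" for x
    using Kx[OF that] by (cases "x = us") (auto simp: k_def complex_eq_iff)
  have Hk: "H x = (x - us)\<^sup>2 * k x" if "x > 0" for x
    using Kx[OF that] by (cases "x = us") (auto simp: k_def)
  have "deriv P (of_real us) = of_real ((\<gamma> + 1) * us powr \<gamma>)"
    using holP us P by (intro deriv_real[where F = "\<lambda>x. x powr (\<gamma> + 1)"])
      (auto intro!: derivative_eq_intros)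
  then have Qus: "Q us = of_real ((\<gamma> + 1) * us powr \<gamma>)" using Q(3) by simp
  have Qx: "Q (of_real x) = of_real ((x powr (\<gamma> + 1) - s) / (x - us))" if "x > 0" "x \<noteq> us" for x
    using Q(2)[of "of_real x"] P[OF that(1)] P[OF us] that by (simp add: s_def field_simps)
  have Qq: "Q (of_real x) = of_real (q x)" if "x > 0" for x
    using Qx[OF that] Qus by (cases "x = us") (auto simp: q_def)
  have Pq: "x powr (\<gamma> + 1) - us powr (\<gamma> + 1) = (x - us) * q x" if "x > 0" for x
    using Qx[OF that] by (cases "x = us") (auto simp: q_def s_def)
  have q: "q x > 0" if "x > 0" for x
  proof (cases x us rule: linorder_cases)
    case less
    then have "x powr (\<gamma> + 1) < us powr (\<gamma> + 1)"
      using that gamma by (intro powr_less_mono2) auto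
    then have "(x - us) * q x < 0" using Pq[OF that] by simp
    then show ?thesis using less by (simp add: mult_less_0_iff)
  next
    case equal
    then show ?thesis using Qus us gamma by (simp add: q_def)
  next
    case greater
    then have "us powr (\<gamma> + 1) < x powr (\<gamma> + 1)"
      using us gamma by (intro powr_less_mono2) auto
    then have "(x - us) * q x > 0" using Pq[OF that] by simp
    then show ?thesis using greater by (simp add: zero_less_mult_iff)
  qed
  define p where "p x = J / uI * x powr (- \<gamma> - 1) * (uI - x)" for x
  have h: "h x = (x - us) * (p x * q x)" if "x > 0" for x
  proof -
    have "x powr (- \<gamma> - 1) * x powr (\<gamma> + 1) = 1"
      using that by (simp flip: powr_add)
    then have "1 - us powr (\<gamma> + 1) * x powr (- \<gamma> - 1) =
        x powr (- \<gamma> - 1) * (x powr (\<gamma> + 1) - us powr (\<gamma> + 1))"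
      by (simp add: right_diff_distrib)
    then have "h x = p x * (x powr (\<gamma> + 1) - us powr (\<gamma> + 1))"
      unfolding h_alt[OF that] p_def by simp
    then show ?thesis using Pq[OF that] by simp
  qed
  have off: "2 * k x + (x - us) * k' x = p x * q x" if "x > 0" "x \<noteq> us" for x
  proof -
    have "((\<lambda>x. (x - us)\<^sup>2 * k x) has_real_derivative 2 * (x - us) * k x + (x - us)\<^sup>2 * k' x) (at x)"
      using k'[OF that(1)] by (auto intro!: derivative_eq_intros)
    then have "(H has_real_derivative 2 * (x - us) * k x + (x - us)\<^sup>2 * k' x) (at x)"
      by (rule has_field_derivative_transform_within_open[where S = "{0<..}"]) (use that Hk in auto)
    then have "2 * (x - us) * k x + (x - us)\<^sup>2 * k' x = (x - us) * (p x * q x)"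
      using DERIV_unique H_deriv[OF that(1)] h[OF that(1)] by metis
    then have "(x - us) * (2 * k x + (x - us) * k' x) = (x - us) * (p x * q x)"
      by (simp add: algebra_simps power2_eq_square)
    then show ?thesis using that by simp
  qed
  \<comment> \<open>All terms are continuous at \<open>us\<close>, being built from real parts of
    holomorphic functions and elementary functions.\<close>
  have "2 * k us + (us - us) * k' us - p us * q us = 0"
  proof (rule zero[where F = "\<lambda>x. 2 * k x + (x - us) * k' x - p x * q x"])
    show "isCont (\<lambda>x. 2 * k x + (x - us) * k' x - p x * q x) us"
      unfolding k_def k'_def p_def q_def
      by (intro continuous_intros cont(1)[OF K(1)] cont(1)[OF Q(1)] cont(1)[OF holomorphic_deriv[OF K(1) S]])
        (use us in auto)
  qed (use off in auto)
  then have "2 * k x + (x - us) * k' x = p x * q x" if "x > 0" for x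
    using off[OF that] by (cases "x = us") auto
  then show ?thesis
    using that[of K Q k q k', OF K(1) Q(1) Kk Qq Hk Pq q k'] by (simp add: p_def)
qed
end

section \<open>The accelerating branch: finite life span, conserved energy, uniqueness\<close>

lemma smooth_on_imp_continuous_on: "smooth_on S f \<Longrightarrow> continuous_on S f"
  unfolding smooth_on_def by (metis DERIV_continuous_on)

lemma smooth_on_imp_deriv:
  assumes "smooth_on S f" "x \<in> interior S"
  obtains d where "(f has_real_derivative d) (at x)"
proof -
  have "x \<in> S" using assms(2) interior_subset by blast
  with assms that show thesis
    unfolding smooth_on_def by (metis at_within_interior)
qed

lemma sq_eq_same_sign:
  fixes a b c :: real
  assumes "a\<^sup>2 = b\<^sup>2" "c * a \<ge> 0" "c * b \<ge> 0" "c \<noteq> 0"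
  shows "a = b"
  using assms by (auto simp: power2_eq_iff zero_le_mult_iff)

text \<open>\<open>V\<close> and \<open>e\<close> give \<open>u'\<close> and \<open>E\<close> as functions of \<open>u\<close> along the accelerating branch.\<close>

locale accelerating_branch = accelerating_flow +
  fixes V e :: "real \<Rightarrow> real"
  assumes V_cont: "continuous_on {0<..<umax} V"
    and V_pos: "w \<in> {0<..<umax} \<Longrightarrow> V w > 0"
    and e_sq: "w \<in> {0<..<umax} \<Longrightarrow> (e w)\<^sup>2 = 2 * H w"
    and e_sign: "w \<in> {0<..<umax} \<Longrightarrow> (w - us) * e w \<ge> 0"
    and V_eq: "w \<in> {0<..<umax} \<Longrightarrow> V w * (w powr (\<gamma> + 1) - us powr (\<gamma> + 1)) = e w * w powr \<gamma>"
    and e_deriv: "w \<in> {0<..<umax} \<Longrightarrow> (e has_real_derivative (J / w - J / uI) / V w) (at w)"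
begin

lemma us_in: "us \<in> {0<..<umax}"
  using us uI umax by auto

lemma e_us [simp]: "e us = 0"
  using e_sq[OF us_in] by simp

lemma powr_ne:
  assumes "w > 0" "w \<noteq> us"
  shows "w powr (\<gamma> + 1) - us powr (\<gamma> + 1) \<noteq> 0"
proof (cases "w < us")
  case True
  then have "w powr (\<gamma> + 1) < us powr (\<gamma> + 1)"
    using assms gamma by (intro powr_less_mono2) auto
  then show ?thesis by simp
next
  case False
  then have "us powr (\<gamma> + 1) < w powr (\<gamma> + 1)"
    using assms us gamma by (intro powr_less_mono2) auto
  then show ?thesis by simp
qed

lemma V_div:
  assumes "w \<in> {0<..<umax}" "w \<noteq> us"
  shows "V w = e w * w powr \<gamma> / (w powr (\<gamma> + 1) - us powr (\<gamma> + 1))"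
proof -
  have "w powr (\<gamma> + 1) - us powr (\<gamma> + 1) \<noteq> 0"
    using assms by (intro powr_ne) auto
  from nonzero_eq_divide_eq[OF this] show ?thesis
    using V_eq[OF assms(1)] by blast
qed

text \<open>Away from \<open>us\<close> the sign condition selects one of the two square roots; at
  \<open>us\<close> both are 0. Thus, for velocities in \<open>{0<..<umax}\<close>,
  \<open>T_acc\<close> is the graph of \<open>e\<close>.\<close>

lemma e_unique:
  assumes "w \<in> {0<..<umax}" "F\<^sup>2 = 2 * H w" "(w - us) * F \<ge> 0"
  shows "F = e w"
proof (cases "w = us")
  case True
  then show ?thesis using assms(2) by simp
next
  case False
  have "F\<^sup>2 = (e w)\<^sup>2"
    using assms(2) e_sq[OF assms(1)] by (simp only:)
  then show ?thesis
    by (rule sq_eq_same_sign[OF _ assms(3) e_sign[OF assms(1)]]) (use False in simp)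
qed

text \<open>\<open>G\<close> is an antiderivative of \<open>inverse (V w)\<close> normalised at
  \<open>u0\<close>. Its boundedness expresses the finite life span and is not automatic, as
  \<open>V\<close> tends to 0 at \<open>umax\<close>.\<close>

lemma travel_time:
  assumes "u0 \<in> {0<..<umax}"
  obtains G where "G u0 = 0" "\<And>w. w \<in> {0<..<umax} \<Longrightarrow> (G has_real_derivative inverse (V w)) (at w)"
    "bdd_above (G ` {u0..<umax})"
proof -
  have cont_V: "isCont V w" if "w \<in> {0<..<umax}" for w
    using V_cont that unfolding continuous_on_eq_continuous_at[OF open_greaterThanLessThan] by blast
  have "\<exists>F. \<forall>x::real. ereal 0 < x \<longrightarrow> x < ereal umax \<longrightarrow> (F has_vector_derivative inverse (V x)) (at x)"
  proof (rule einterval_antiderivative)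
    show "isCont (\<lambda>x. inverse (V x)) x" if "ereal 0 < ereal x" "ereal x < ereal umax" for x
      using cont_V[of x] V_pos[of x] that by (intro continuous_intros) auto
  qed (use umax us uI in auto)
  then obtain G0 where G0: "\<And>w. w \<in> {0<..<umax} \<Longrightarrow> (G0 has_real_derivative inverse (V w)) (at w)"
    by (auto simp: has_real_derivative_iff_has_vector_derivative)
  define G where "G w = G0 w - G0 u0" for w
  have G: "(G has_real_derivative inverse (V w)) (at w)" if "w \<in> {0<..<umax}" for w
    unfolding G_def using G0[OF that] by (auto intro!: derivative_eq_intros)
  define u1 where "u1 = (uI + umax) / 2"
  have u1: "uI < u1" "u1 < umax" using umax by (auto simp: u1_def)
  define c where "c = J / uI - J / u1"
  have c: "c > 0" using J us uI u1 by (simp add: c_def divide_strict_left_mono)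
  \<comment> \<open>\<open>c \<le> - dE/dx\<close> past \<open>u\<^sub>1\<close>, whereas \<open>E\<close> stays nonnegative: the remaining time is finite.\<close>
  have bound: "G w \<le> e u1 / c + G u1" if w: "w \<in> {u1..<umax}" for w
  proof -
    \<comment> \<open>In the state variable both slopes carry a factor \<open>1 / V\<close>: that of
      \<open>e\<close> is \<open>J / w - J / uI\<close> and that of \<open>G\<close> is 1, times
      this factor. So the sign is decided by \<open>J / w - J / u1\<close>.\<close>
    have "e w + c * G w \<le> e u1 + c * G u1"
    proof (rule DERIV_nonpos_imp_nonincreasing[where f = "\<lambda>w. e w + c * G w"])
      fix x assume x: "u1 \<le> x" "x \<le> w"
      then have xI: "x \<in> {0<..<umax}" using w u1 us uI by auto
      have "((\<lambda>w. e w + c * G w) has_real_derivative (J / x - J / uI) / V x + c * inverse (V x)) (at x)"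
        using e_deriv[OF xI] G[OF xI] by (auto intro!: derivative_eq_intros)
      moreover have "(J / x - J / uI) / V x + c * inverse (V x) = (J / x - J / u1) / V x"
        by (simp add: c_def field_simps diff_divide_distrib)
      moreover have "J / x - J / u1 \<le> 0"
        using x J u1 us uI by (simp add: divide_left_mono)
      ultimately show "\<exists>y. ((\<lambda>w. e w + c * G w) has_real_derivative y) (at x) \<and> y \<le> 0"
        using V_pos[OF xI] by (metis divide_nonpos_pos)
    qed (use w in auto)
    moreover have "e w \<ge> 0"
      using e_sign[of w] w u1 us uI by (auto simp: zero_le_mult_iff)
    ultimately have "c * G w \<le> e u1 + c * G u1" by simp
    then show ?thesis using c by (simp add: field_simps)
  qed
  have "G w \<le> e u1 / c + G u1" if w: "w \<in> {u0..<umax}" for w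
  proof (cases "w < u1")
    case True
    have "G w \<le> G u1"
    proof (rule DERIV_nonneg_imp_nondecreasing[where f = G])
      fix x assume "w \<le> x" "x \<le> u1"
      then have xI: "x \<in> {0<..<umax}" using assms w u1 by auto
      then show "\<exists>y. (G has_real_derivative y) (at x) \<and> 0 \<le> y"
        using G[OF xI] V_pos[OF xI] by (intro exI[of _ "inverse (V x)"]) simp
    qed (use True in auto)
    then show ?thesis using bound[of u1] u1 by auto
  qed (use bound w in auto)
  then have "bdd_above (G ` {u0..<umax})" by (rule bdd_aboveI2)
  then show ?thesis
    using that[of G] G by (simp add: G_def)
qed

text \<open>Away from \<open>us\<close> the first equation gives
  \<open>h (v y) * d = F y * (J / v y - J / uI)\<close>, with \<open>d\<close> the derivative of
  \<open>v\<close>, so the two contributions to the derivative of \<open>N\<close> cancel. At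
  \<open>us\<close> each vanishes separately, since \<open>F y = 0\<close> and
  \<open>h us = 0\<close>.\<close>

lemma energy:
  assumes sol: "smooth_solution \<gamma> J us (J / uI) u0 E0 l v F" and E0: "E0\<^sup>2 = 2 * H u0"
    and x: "x \<in> {0..<l}"
  shows "(F x)\<^sup>2 = 2 * H (v x)"
proof -
  define N where "N y = (F y)\<^sup>2 - 2 * H (v y)" for y
  have pos: "v y > 0" if "y \<in> {0..<l}" for y
    using sol that by (auto simp: smooth_solution_def)
  have cont: "continuous_on {0..<l} v" "continuous_on {0..<l} F"
    using sol smooth_on_imp_continuous_on by (auto simp: smooth_solution_def)
  have contN: "continuous_on {0..<l} N"
    unfolding N_def using pos
    by (intro continuous_intros cont continuous_on_compose2[OF H_continuous cont(1)]) auto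
  have dN: "(N has_real_derivative 0) (at y)" if y: "0 < y" "y < l" for y
  proof -
    obtain d where d: "(v has_real_derivative d) (at y)"
      using sol y smooth_on_imp_deriv[of "{0..<l}" v y] by (auto simp: smooth_solution_def)
    have dF: "(F has_real_derivative J / v y - J / uI) (at y)"
      using sol y by (auto simp: smooth_solution_def)
    have vy: "v y > 0" using pos y by auto
    have "((\<lambda>y. H (v y)) has_real_derivative h (v y) * d) (at y)"
      using DERIV_chain2[OF H_deriv[OF vy] d] .
    then have "(N has_real_derivative 2 * (F y * (J / v y - J / uI) - h (v y) * d)) (at y)"
      unfolding N_def using dF by (auto intro!: derivative_eq_intros)
    moreover have "F y * (J / v y - J / uI) - h (v y) * d = 0"
    proof (cases "v y = us")
      case True
      then show ?thesis using sol y by (auto simp: smooth_solution_def h_def)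
    next
      case False
      define D where "D = v y powr (\<gamma> + 1) - us powr (\<gamma> + 1)"
      have D: "D \<noteq> 0" using powr_ne[OF vy False] by (simp add: D_def)
      have "(v has_real_derivative F y * v y powr \<gamma> / D) (at y)"
        using sol y False unfolding D_def by (auto simp: smooth_solution_def)
      then have d_eq: "d = F y * v y powr \<gamma> / D" using d DERIV_unique by blast
      have h_eq: "h (v y) = J / (uI * (v y * v y powr \<gamma>)) * D * (uI - v y)"
        using vy by (simp add: h_def D_def powr_mult_base add.commute)
      show ?thesis unfolding d_eq h_eq using D vy us uI by (simp add: field_simps)
    qed
    ultimately show ?thesis by simp
  qed
  \<comment> \<open>The equations are imposed only for positive times; continuity of
    \<open>N\<close> includes the initial time.\<close>
  have "N x = N 0"
  proof (cases "x = 0")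
    case False
    then show ?thesis using x dN
      by (intro DERIV_isconst2[of 0 x] continuous_on_subset[OF contN]) auto
  qed simp
  also have "\<dots> = 0"
    using sol E0 by (auto simp: smooth_solution_def N_def)
  finally show ?thesis by (simp add: N_def)
qed

text \<open>A first-failure argument: let \<open>m\<close> be the infimum of the times of
  disagreement. Agreement persists at \<open>m\<close> by continuity, and just after
  \<open>m\<close> the competitor lies on the branch, where it solves \<open>v' = V v\<close> and is
  recovered from its travel time \<open>G\<close>. This contradicts the choice of
  \<open>m\<close>.\<close>

lemma uniqueness:
  assumes G: "\<And>w. w \<in> {0<..<umax} \<Longrightarrow> (G has_real_derivative inverse (V w)) (at w)"
    and uG: "\<And>w. w \<in> {0<..<umax} \<Longrightarrow> u (G w) = w"
    and Gu: "\<And>x. x \<in> {0..<l} \<Longrightarrow> G (u x) = x"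
    and u: "\<And>x. x \<in> {0..<l} \<Longrightarrow> u x \<in> {0<..<umax}"
    and du: "\<And>x. x \<in> {0..<l} \<Longrightarrow> (u has_real_derivative V (u x)) (at x)"
    and u0: "u 0 = u0" "u0 < us"
    and sol: "smooth_solution \<gamma> J us (J / uI) u0 (e u0) l v F"
    and x: "x \<in> {0..<l}"
  shows "v x = u x \<and> F x = e (u x)"
proof (rule ccontr)
  assume bad: "\<not> ?thesis"
  define B where "B = {x\<in>{0..<l}. \<not> (v x = u x \<and> F x = e (u x))}"
  define m where "m = Inf B"
  have bdd: "bdd_below B" by (auto simp: B_def intro!: bdd_belowI[of _ 0])
  have xB: "x \<in> B" using bad x by (auto simp: B_def)
  have "0 \<le> m" unfolding m_def using xB by (intro cInf_greatest) (auto simp: B_def)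
  moreover have "m \<le> x" unfolding m_def using xB bdd by (intro cInf_lower)
  ultimately have m: "m \<in> {0..<l}" using x by auto
  have l0: "0 \<in> {0..<l}" using x by auto
  have below: "v y = u y" "F y = e (u y)" if "0 \<le> y" "y < m" for y
    using that m cInf_lower[OF _ bdd, of y] unfolding m_def[symmetric] by (auto simp: B_def)
  have pos: "v y > 0" if "y \<in> {0..<l}" for y
    using sol that by (auto simp: smooth_solution_def)
  have cont: "continuous_on {0..<l} v" "continuous_on {0..<l} F"
    using sol smooth_on_imp_continuous_on by (auto simp: smooth_solution_def)
  have cont_u: "continuous_on {0..<l} u"
    by (intro continuous_at_imp_continuous_on ballI DERIV_isCont[OF du])
  have cont_e: "continuous_on {0<..<umax} e"
    by (intro continuous_at_imp_continuous_on ballI DERIV_isCont[OF e_deriv])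
  have cont_eu: "continuous_on {0..<l} (\<lambda>y. e (u y))"
    using u by (intro continuous_on_compose2[OF cont_e cont_u]) auto
  have u0I: "u0 \<in> {0<..<umax}" using u[OF l0] u0 by simp
  have en: "(F y)\<^sup>2 = 2 * H (v y)" if "y \<in> {0..<l}" for y
    by (rule energy[OF sol e_sq[OF u0I] that])
  \<comment> \<open>At time 0 this is the initial condition; otherwise both differences vanish to
    the left of \<open>m\<close> and are continuous.\<close>
  have at_m: "v m = u m \<and> F m = e (u m)"
  proof (cases "m = 0")
    case True
    then show ?thesis using sol u0 by (simp add: smooth_solution_def)
  next
    case False
    then have m0: "m > 0" using m by simp
    have "continuous_on {0..m} (\<lambda>y. v y - u y)" "continuous_on {0..m} (\<lambda>y. F y - e (u y))"
      using m by (auto intro!: continuous_on_diff continuous_on_subset[OF cont(1)]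
        continuous_on_subset[OF cont(2)] continuous_on_subset[OF cont_u] continuous_on_subset[OF cont_eu])
    then have "((\<lambda>y. v y - u y) \<longlongrightarrow> v m - u m) (at_left m)"
      "((\<lambda>y. F y - e (u y)) \<longlongrightarrow> F m - e (u m)) (at_left m)"
      using m0 by (auto intro: continuous_on_Icc_at_leftD)
    moreover have "\<forall>\<^sub>F y in at_left m. y \<in> {0<..<m}"
      using m0 by (intro eventually_at_leftI[of 0]) auto
    then have "\<forall>\<^sub>F y in at_left m. v y - u y = 0" "\<forall>\<^sub>F y in at_left m. F y - e (u y) = 0"
      by (auto elim!: eventually_mono simp: below)
    then have "((\<lambda>y. v y - u y) \<longlongrightarrow> 0) (at_left m)" "((\<lambda>y. F y - e (u y)) \<longlongrightarrow> 0) (at_left m)"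
      by (auto intro: tendsto_eventually)
    ultimately show ?thesis
      using tendsto_unique[OF trivial_limit_at_left_real] by (metis eq_iff_diff_eq_0)
  qed
  have tend: "(v \<longlongrightarrow> v m) (at_right m)" "(F \<longlongrightarrow> F m) (at_right m)"
    using m by (auto intro!: continuous_on_Icc_at_rightD[where b = "(m + l) / 2"] continuous_on_subset[OF cont(1)]
        continuous_on_subset[OF cont(2)])
  \<comment> \<open>A positive product keeps \<open>v\<close> off the sonic value and fixes the sign
    of \<open>F\<close>, so that energy conservation forces \<open>F y = e (v y)\<close>.\<close>
  have "\<forall>\<^sub>F y in at_right m. (v y - us) * F y > 0"
  proof (cases "u m = us")
    case False
    have "(e (u m))\<^sup>2 > 0"
      using e_sq[OF u[OF m]] H_pos[of "u m"] u[OF m] False by simp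
    then have "(v m - us) * F m > 0"
      using at_m e_sign[OF u[OF m]] False by (auto simp: less_le)
    moreover have "((\<lambda>y. (v y - us) * F y) \<longlongrightarrow> (v m - us) * F m) (at_right m)"
      by (intro tendsto_intros tend)
    ultimately show ?thesis using order_tendstoD(1) by blast
  next
    \<comment> \<open>Here smoothness enters: \<open>v'\<close> at the sonic point is determined by the left of it.\<close>
    case True
    then have m0: "m > 0" using m u0 by (metis atLeastLessThan_iff less_irrefl less_le)
    obtain d where d: "(v has_real_derivative d) (at m)"
      using sol m m0 smooth_on_imp_deriv[of "{0..<l}" v m] by (auto simp: smooth_solution_def)
    have eq: "u y = v y" if "y \<in> {0..m}" for y
      using below(1)[of y] at_m that by (cases "y = m") auto
    have "(v has_real_derivative V (u m)) (at m within {0..m})"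
      by (rule has_field_derivative_transform_within[OF has_field_derivative_at_within[OF du[OF m]], of 1])
        (use m eq in auto)
    moreover have "at m within {0..m} \<noteq> bot"
      using m0 by (simp add: at_within_Icc_at_left)
    ultimately have "d = V (u m)"
      using has_field_derivative_unique has_field_derivative_at_within[OF d] by blast
    then have d0: "d > 0" using V_pos[OF u[OF m]] by simp
    have "(F has_real_derivative J / v m - J / uI) (at m)"
      using sol m m0 by (auto simp: smooth_solution_def)
    then have dF: "(F has_real_derivative J / us - J / uI) (at m)"
      using at_m True by simp
    \<comment> \<open>\<open>F\<close> and \<open>v - us\<close> both vanish at \<open>m\<close> and
      have positive derivatives there, so both are positive just after \<open>m\<close>.\<close>
    have "J / us - J / uI > 0" using J us uI by (simp add: divide_strict_left_mono)
    from DERIV_pos_inc_right[OF dF this] DERIV_pos_inc_right[OF d d0]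
    obtain a b where a: "a > 0" "\<And>h. 0 < h \<Longrightarrow> h < a \<Longrightarrow> F m < F (m + h)"
      and b: "b > 0" "\<And>h. 0 < h \<Longrightarrow> h < b \<Longrightarrow> v m < v (m + h)" by metis
    have "(v y - us) * F y > 0" if "m < y" "y < m + min a b" for y
      using a(2)[of "y - m"] b(2)[of "y - m"] that at_m True by simp
    then show ?thesis
      using a b by (intro eventually_at_rightI[of m "m + min a b"]) auto
  qed
  then obtain r where r: "r > m" "\<And>y. m < y \<Longrightarrow> y < r \<Longrightarrow> (v y - us) * F y > 0"
    by (auto simp: eventually_at_right[of m "m + 1", simplified])
  define r' where "r' = min r l"
  have good: "v y = u y \<and> F y = e (u y)" if y: "m < y" "y < r'" for y
  proof -
    \<comment> \<open>Here \<open>F z\<close> is nonzero, so \<open>H (v z) > 0\<close> by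
      conservation of energy, which excludes velocities from \<open>umax\<close> on.\<close>
    have vI: "v z \<in> {0<..<umax}" "v z \<noteq> us" "F z = e (v z)" if z: "m < z" "z \<le> y" for z
    proof -
      have z': "z \<in> {0..<l}" "(v z - us) * F z > 0" using z y m r(2)[of z] by (auto simp: r'_def)
      then have "F z \<noteq> 0" "v z \<noteq> us" by auto
      then have "H (v z) > 0" using en[OF z'(1)] by (metis zero_less_power2 zero_less_mult_pos zero_less_numeral)
      then show vz: "v z \<in> {0<..<umax}"
        using pos[OF z'(1)] H_neg[of "v z"] umax(2) by (cases "v z" umax rule: linorder_cases) auto
      show "v z \<noteq> us" by fact
      show "F z = e (v z)" by (rule e_unique[OF vz en[OF z'(1)]]) (use z' in simp)
    qed
    have vI': "v z \<in> {0<..<umax}" if "m \<le> z" "z \<le> y" for z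
      using vI(1)[of z] at_m u[OF m] that by (cases "z = m") auto
    \<comment> \<open>Along \<open>v' = V v\<close> the travel time \<open>G (v z)\<close> grows at
      rate 1.\<close>
    have "G (v y) - y = G (v m) - m"
    proof (rule DERIV_isconst2[of m y "\<lambda>z. G (v z) - z"])
      have "continuous_on {0<..<umax} G"
        by (intro continuous_at_imp_continuous_on ballI DERIV_isCont[OF G])
      then show "continuous_on {m..y} (\<lambda>z. G (v z) - z)"
        using vI' m y by (intro continuous_intros continuous_on_compose2[of _ G _ v] continuous_on_subset[OF cont(1)])
          (auto simp: r'_def)
      fix z assume z: "m < z" "z < y"
      have "z \<in> {0<..<l}" using z m y by (auto simp: r'_def)
      then have "(v has_real_derivative V (v z)) (at z)"
        using sol vI[of z] z V_div[of "v z"] by (auto simp: smooth_solution_def)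
      from DERIV_chain2[OF G this] have "((\<lambda>z. G (v z)) has_real_derivative 1) (at z)"
        using vI(1)[of z] V_pos[of "v z"] z by auto
      then show "((\<lambda>z. G (v z) - z) has_real_derivative 0) (at z)"
        by (auto intro!: derivative_eq_intros)
    qed (use y in auto)
    then have "G (v y) = y" using at_m Gu[OF m] by simp
    then show ?thesis using uG[of "v y"] vI[of y] y by auto
  qed
  have "m < r'" using r m by (auto simp: r'_def)
  then obtain b where b: "b \<in> B" "b < r'"
    using cInf_lessD[of B r'] xB unfolding m_def by auto
  then show False
    using below[of b] at_m good[of b] by (cases b m rule: linorder_cases) (auto simp: B_def)
qed

end

section \<open>Construction of the branch from the factorisation\<close>

context accelerating_flow
begin

text \<open>The common factor \<open>x - us\<close> of \<open>e\<close> and of the power difference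
  cancels in \<open>V\<close>, so \<open>V\<close> is regular and positive across \<open>us\<close>.
  Positivity of \<open>k\<close> keeps \<open>2 * K z\<close> off the cut of \<open>csqrt\<close>,
  so \<open>Vc\<close> and \<open>ec\<close> are analytic along the real interval; they serve to
  prove smoothness.\<close>

lemma ex_accelerating_branch:
  obtains V e and Vc ec :: "complex \<Rightarrow> complex" where "accelerating_branch \<gamma> J us uI V e"
    "Vc analytic_on complex_of_real ` {0<..<umax}" "ec analytic_on complex_of_real ` {0<..<umax}"
    "\<And>w. w \<in> {0<..<umax} \<Longrightarrow> Vc (of_real w) = of_real (V w)"
    "\<And>w. e w = Re (ec (of_real w))"
proof -
  obtain K Q k q k' where holK: "K holomorphic_on {z. Re z > 0}" and holQ: "Q holomorphic_on {z. Re z > 0}"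
    and K: "\<And>x. x > 0 \<Longrightarrow> K (of_real x) = of_real (k x)"
    and Q: "\<And>x. x > 0 \<Longrightarrow> Q (of_real x) = of_real (q x)"
    and Hk: "\<And>x. x > 0 \<Longrightarrow> H x = (x - us)\<^sup>2 * k x"
    and Pq: "\<And>x. x > 0 \<Longrightarrow> x powr (\<gamma> + 1) - us powr (\<gamma> + 1) = (x - us) * q x"
    and q: "\<And>x. x > 0 \<Longrightarrow> q x > 0"
    and k': "\<And>x. x > 0 \<Longrightarrow> (k has_real_derivative k' x) (at x)"
    and kk': "\<And>x. x > 0 \<Longrightarrow> 2 * k x + (x - us) * k' x = J / uI * x powr (- \<gamma> - 1) * (uI - x) * q x"
    by (rule factorisation) (rule that)
  let ?I = "{0<..<umax}"
  let ?C = "complex_of_real ` ?I"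
  \<comment> \<open>Away from \<open>us\<close> this is the sign of \<open>H\<close>; at
    \<open>us\<close> it follows from the differentiated identity and uses
    \<open>us < uI\<close>.\<close>
  have k: "k x > 0" if "x \<in> ?I" for x
  proof (cases "x = us")
    case True
    then have "2 * k x = J / uI * us powr (- \<gamma> - 1) * (uI - us) * q us"
      using kk'[OF us] by simp
    also have "\<dots> > 0" using J us uI q[OF us] by (intro mult_pos_pos divide_pos_pos) auto
    finally show ?thesis by simp
  next
    case False
    then have "(x - us)\<^sup>2 * k x > 0" using H_pos[of x] Hk[of x] that by auto
    then show ?thesis by (simp add: zero_less_mult_iff)
  qed
  have S: "open {z. Re z > 0}" by (rule open_halfspace_Re_gt)
  have anK: "K analytic_on ?C" and anQ: "Q analytic_on ?C"
    by (rule analytic_on_subset[OF analytic_on_open[OF S, THEN iffD2]]; use holK holQ in force)+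
  define Vc where "Vc z = csqrt (2 * K z) * z powr of_real \<gamma> / Q z" for z
  define ec where "ec z = (z - of_real us) * csqrt (2 * K z)" for z
  define V where "V x = sqrt (2 * k x) * x powr \<gamma> / q x" for x
  define e where "e x = Re (ec (of_real x))" for x
  have root: "csqrt (2 * K (of_real x)) = of_real (sqrt (2 * k x))" if "x \<in> ?I" for x
    using that k[OF that] K[of x] csqrt_of_real[of "2 * k x"] by simp
  have e: "e x = (x - us) * sqrt (2 * k x)" if "x \<in> ?I" for x
    unfolding e_def ec_def root[OF that] by (simp flip: of_real_diff)
  have anr: "(\<lambda>z. csqrt (2 * K z)) analytic_on ?C"
  proof (rule analytic_on_csqrt')
    show "(\<lambda>z. 2 * K z) analytic_on ?C" by (intro analytic_intros anK)
    fix z assume "z \<in> ?C"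
    then obtain x where x: "z = of_real x" "x \<in> ?I" by blast
    then show "2 * K z \<notin> \<real>\<^sub>\<le>\<^sub>0"
      using k[OF x(2)] K[of x] by (auto simp: complex_nonpos_Reals_iff)
  qed
  show thesis
  proof (rule that[of V e Vc ec])
    have "(\<lambda>z. z powr of_real \<gamma>) analytic_on ?C"
      by (intro analytic_intros) (auto simp: complex_nonpos_Reals_iff)
    moreover have "Q z \<noteq> 0" if z: "z \<in> ?C" for z
    proof -
      obtain x where x: "z = of_real x" "x > 0" using z by auto
      then show ?thesis using Q[OF x(2)] q[OF x(2)] by simp
    qed
    ultimately show "Vc analytic_on ?C"
      unfolding Vc_def by (intro analytic_on_divide analytic_on_mult anr anQ)
    show "ec analytic_on ?C"
      unfolding ec_def by (rule analytic_on_mult[OF _ anr]) (intro analytic_intros)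
    show "Vc (of_real w) = of_real (V w)" if "w \<in> ?I" for w
      unfolding Vc_def V_def root[OF that] using that Q[of w] powr_of_real[of w \<gamma>] by simp
    show "e w = Re (ec (of_real w))" for w by (simp add: e_def)
    show "accelerating_branch \<gamma> J us uI V e"
    proof
      have cont_k: "continuous_on {0<..} k"
        by (intro continuous_at_imp_continuous_on ballI DERIV_isCont[OF k']) simp
      have "continuous_on {0<..} (\<lambda>x. Re (Q (of_real x)))"
        by (intro continuous_intros continuous_on_compose2[OF holomorphic_on_imp_continuous_on[OF holQ]]) auto
      then have cont_q: "continuous_on {0<..} q"
        by (rule continuous_on_eq) (use Q in auto)
      show "continuous_on ?I V"
        unfolding V_def using q
        by (intro continuous_intros continuous_on_subset[OF cont_k] continuous_on_subset[OF cont_q])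
          (auto simp: less_imp_neq[symmetric])
      fix w assume w: "w \<in> ?I"
      then have w0: "w > 0" by simp
      show "V w > 0" using w k[OF w] q[OF w0] by (simp add: V_def)
      show "(e w)\<^sup>2 = 2 * H w"
        using k[OF w] Hk[OF w0] e[OF w] by (simp add: power_mult_distrib)
      show "(w - us) * e w \<ge> 0"
        using k[OF w] e[OF w] by (simp flip: mult.assoc)
      show "V w * (w powr (\<gamma> + 1) - us powr (\<gamma> + 1)) = e w * w powr \<gamma>"
        using q[OF w0] e[OF w] Pq[OF w0] by (simp add: V_def)
      have "((\<lambda>x. (x - us) * sqrt (2 * k x)) has_real_derivative
          sqrt (2 * k w) + (w - us) * (2 * k' w * (inverse (sqrt (2 * k w)) / 2))) (at w)"
        using k[OF w] by (auto intro!: derivative_eq_intros k'[OF w0])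
      then have "(e has_real_derivative
          sqrt (2 * k w) + (w - us) * (2 * k' w * (inverse (sqrt (2 * k w)) / 2))) (at w)"
        by (rule has_field_derivative_transform_within_open[where S = ?I]) (use w e in auto)
      also have "sqrt (2 * k w) + (w - us) * (2 * k' w * (inverse (sqrt (2 * k w)) / 2)) =
          (2 * k w + (w - us) * k' w) / sqrt (2 * k w)"
      proof -
        have *: "r + d * (2 * m * (inverse r / 2)) = (r * r + d * m) / r" if "r \<noteq> 0" for r d m :: real
          using that by (simp add: field_simps)
        have root: "sqrt (2 * k w) * sqrt (2 * k w) = 2 * k w" "sqrt (2 * k w) \<noteq> 0"
          using k[OF w] by simp_all
        show ?thesis
          using *[OF root(2), of "w - us" "k' w"] by (simp only: root(1))
      qed
      also have "\<dots> = (J / w - J / uI) / V w"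
      proof -
        have "w powr (- \<gamma> - 1) = w powr - (\<gamma> + 1)" by simp
        also have "\<dots> = 1 / (w powr \<gamma> * w)"
          using w0 by (simp only: powr_minus_divide powr_add powr_one less_imp_le)
        finally have "w powr (- \<gamma> - 1) = 1 / (w powr \<gamma> * w)" .
        \<comment> \<open>The factor \<open>q w\<close> of this numerator is the one that
          \<open>V\<close> has in its denominator; what remains is the right-hand side of the
          equation for \<open>E\<close>.\<close>
        then have num: "2 * k w + (w - us) * k' w = J / uI * (1 / (w powr \<gamma> * w)) * (uI - w) * q w"
          using kk'[OF w0] by simp
        have "sqrt (2 * k w) > 0" "w powr \<gamma> > 0" using k[OF w] w0 by simp_all
        then show ?thesis
          unfolding V_def num using w0 us uI q[OF w0] by (simp add: field_simps)
      qed
      finally show "(e has_real_derivative (J / w - J / uI) / V w) (at w)" .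
    qed
  qed
qed

end

section \<open>The solution and its properties\<close>

text \<open>The conclusion of the theorem with the life span \<open>l\<close> and the sonic position
  \<open>c\<close> as parameters, so that they can be chosen before \<open>E0\<close>.\<close>

definition accelerates ::
  "real \<Rightarrow> real \<Rightarrow> real \<Rightarrow> real \<Rightarrow> real \<Rightarrow> real \<Rightarrow> real \<Rightarrow> real \<Rightarrow> real \<Rightarrow> bool"
where
  "accelerates \<gamma> J us \<rho>I uI u0 E0 l c \<longleftrightarrow>
     l > 0 \<and>
     (\<exists>u E u' :: real \<Rightarrow> real.
        smooth_solution \<gamma> J us \<rho>I u0 E0 l u E \<and>
        (\<forall>v F. smooth_solution \<gamma> J us \<rho>I u0 E0 l v F \<longrightarrow>
           (\<forall>x\<in>{0..<l}. v x = u x \<and> F x = E x)) \<and>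
        (\<forall>x\<in>{0..<l}. (u has_real_derivative u' x) (at x within {0..<l})) \<and>
        (\<forall>x\<in>{0..<l}. u' x > 0) \<and>
        (u' \<longlongrightarrow> 0) (at_left l) \<and>
        (\<exists>ul El. (u \<longlongrightarrow> ul) (at_left l) \<and> (E \<longlongrightarrow> El) (at_left l) \<and>
           T_acc \<gamma> J us uI \<inter> insert (ul, El) ((\<lambda>x. (u x, E x)) ` {0..<l}) =
           T_acc \<gamma> J us uI \<inter> {(w, G). w \<ge> u0}) \<and>
        (\<forall>x. sonic_crossing us l u x \<longleftrightarrow> x = c))"

text \<open>The constants can precede \<open>E0\<close> because membership in \<open>T_acc\<close>
  forces \<open>E0 = e u0\<close>. The solution is the inverse \<open>u\<close> of the travel time
  together with \<open>e\<close> evaluated along \<open>u\<close>.\<close>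

lemma (in accelerating_flow) ex_accelerates:
  assumes u0: "0 < u0" "u0 < us"
  shows "\<exists>l c. \<forall>E0. (u0, E0) \<in> T_acc \<gamma> J us uI \<longrightarrow> accelerates \<gamma> J us (J / uI) uI u0 E0 l c"
proof -
  obtain V e Vc ec where "accelerating_branch \<gamma> J us uI V e"
    and Vc: "Vc analytic_on complex_of_real ` {0<..<umax}"
    and ec: "ec analytic_on complex_of_real ` {0<..<umax}"
    and V: "\<And>w. w \<in> {0<..<umax} \<Longrightarrow> Vc (of_real w) = of_real (V w)"
    and e: "\<And>w. e w = Re (ec (of_real w))"
    by (rule ex_accelerating_branch) (rule that)
  then interpret accelerating_branch \<gamma> J us uI V e by -
  have u0I: "u0 \<in> {0<..<umax}" using u0 us_in by simp
  obtain G where G0: "G u0 = 0"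
    and G: "\<And>w. w \<in> {0<..<umax} \<Longrightarrow> (G has_real_derivative inverse (V w)) (at w)"
    and bdd: "bdd_above (G ` {u0..<umax})"
    by (rule travel_time[OF u0I]) (rule that)
  obtain l u where l: "l > 0" and uG: "\<And>w. w \<in> {0<..<umax} \<Longrightarrow> u (G w) = w"
    and Gu: "\<And>x. x \<in> {0..<l} \<Longrightarrow> G (u x) = x"
    and im: "u ` {0..<l} = {u0..<umax}" and mono: "strict_mono_on {0..<l} u"
    and du: "\<And>x. x \<in> {0..<l} \<Longrightarrow> (u has_real_derivative V (u x)) (at x)"
    and lim: "(u \<longlongrightarrow> umax) (at_left l)"
    by (rule autonomous_solution[OF u0I V_pos G G0 bdd]; (assumption | rule that; assumption))
  have uI': "u x \<in> {0<..<umax}" if "x \<in> {0..<l}" for x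
  proof -
    have "u x \<in> {u0..<umax}" using im that by blast
    then show ?thesis using u0 by auto
  qed
  have u_0: "u 0 = u0" using uG[OF u0I] G0 by simp
  have near: "\<forall>\<^sub>F x in at_left l. x \<in> {0<..<l}"
    using l by (intro eventually_at_leftI[of 0]) auto
  have sol: "smooth_solution \<gamma> J us (J / uI) u0 (e u0) l u (\<lambda>x. e (u x))"
    unfolding smooth_solution_def
  proof (intro conjI ballI)
    \<comment> \<open>The analytic flow lemma is used with the identity for \<open>u\<close> and
      with \<open>ec\<close> for the field.\<close>
    have "smooth_on {0..<l} (\<lambda>x. Re (of_real (u x)))"
      by (rule smooth_on_analytic_flow[OF analytic_on_ident Vc V uI'])
        (auto intro!: has_field_derivative_at_within du)
    then show "smooth_on {0..<l} u" by simp
    show "smooth_on {0..<l} (\<lambda>x. e (u x))"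
      unfolding e by (rule smooth_on_analytic_flow[OF ec Vc V uI'])
        (auto intro!: has_field_derivative_at_within du)
    fix x assume "x \<in> {0<..<l}"
    then have x: "x \<in> {0..<l}" by auto
    note w = uI'[OF x]
    show "u x \<noteq> us \<longrightarrow> (u has_real_derivative
        e (u x) * u x powr \<gamma> / (u x powr (\<gamma> + 1) - us powr (\<gamma> + 1))) (at x)"
      using du[OF x] V_div[OF w] by (intro impI) simp
    show "u x = us \<longrightarrow> e (u x) = 0" by simp
    show "((\<lambda>x. e (u x)) has_real_derivative J / u x - J / uI) (at x)"
      using DERIV_chain2[OF e_deriv[OF w] du[OF x]] V_pos[OF w] by simp
  qed (use u_0 uI' in auto)
  \<comment> \<open>The limit of the field is read off from \<open>\<bar>e (u x)\<bar>\<close>,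
    which is the square root of twice \<open>H (u x)\<close>, and from
    \<open>H umax = 0\<close>.\<close>
  have "((\<lambda>x. sqrt (2 * H (u x))) \<longlongrightarrow> sqrt (2 * H umax)) (at_left l)"
    using H_deriv[of umax] umax us uI
    by (intro tendsto_intros isCont_tendsto_compose[OF _ lim] DERIV_isCont[of H]) auto
  moreover have "\<forall>\<^sub>F x in at_left l. sqrt (2 * H (u x)) = \<bar>e (u x)\<bar>"
    using near
  proof eventually_elim
    case (elim x)
    then have "u x \<in> {0<..<umax}" by (intro uI') auto
    from e_sq[OF this] show ?case by (metis real_sqrt_abs)
  qed
  ultimately have "((\<lambda>x. \<bar>e (u x)\<bar>) \<longlongrightarrow> sqrt (2 * H umax)) (at_left l)"
    by (rule Lim_transform_eventually)
  then have "((\<lambda>x. \<bar>e (u x)\<bar>) \<longlongrightarrow> 0) (at_left l)"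
    by (simp add: umax(2))
  then have lim_e: "((\<lambda>x. e (u x)) \<longlongrightarrow> 0) (at_left l)"
    by (rule tendsto_rabs_zero_cancel)
  have pos: "umax > us" using us_in by simp
  \<comment> \<open>Nothing is known about \<open>V\<close> at \<open>umax\<close> itself, so the
    limit is taken in the quotient form, whose denominator does not vanish there.\<close>
  have "((\<lambda>x. e (u x) * u x powr \<gamma> / (u x powr (\<gamma> + 1) - us powr (\<gamma> + 1)))
      \<longlongrightarrow> 0 * umax powr \<gamma> / (umax powr (\<gamma> + 1) - us powr (\<gamma> + 1))) (at_left l)"
    using powr_ne[of umax] pos us by (intro tendsto_intros lim lim_e) auto
  moreover have "\<forall>\<^sub>F x in at_left l.
      e (u x) * u x powr \<gamma> / (u x powr (\<gamma> + 1) - us powr (\<gamma> + 1)) = V (u x)"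
    using near order_tendstoD(1)[OF lim pos]
  proof eventually_elim
    case (elim x)
    then have "u x \<in> {0<..<umax}" by (intro uI') auto
    then show ?case using V_div elim by simp
  qed
  ultimately have lim_V: "((\<lambda>x. V (u x)) \<longlongrightarrow> 0) (at_left l)"
    using Lim_transform_eventually by fastforce
  have T: "T_acc \<gamma> J us uI \<inter> insert (umax, 0) ((\<lambda>x. (u x, e (u x))) ` {0..<l}) =
      T_acc \<gamma> J us uI \<inter> {(w, G). w \<ge> u0}" (is "?L = ?R")
  proof (intro equalityI subsetI)
    show "p \<in> ?R" if "p \<in> ?L" for p
      using that im u0I by auto
    show "p \<in> ?L" if p: "p \<in> ?R" for p
    proof -
      obtain w F where wF: "p = (w, F)" by fastforce
      then have w: "F\<^sup>2 = 2 * H w" "(w - us) * F \<ge> 0" "w \<ge> u0"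
        using p by (auto simp: T_acc_def)
      \<comment> \<open>Hence \<open>w\<close> is at most \<open>umax\<close>. The end state is the
        inserted limit point, and below it \<open>e_unique\<close> and the range of \<open>u\<close>
        give a point of the trajectory.\<close>
      have "H w \<ge> 0" using w(1) by (metis zero_le_power2 zero_le_mult_iff zero_less_numeral less_le_not_le)
      then consider "w = umax" | "w < umax" using H_neg[of w] by (cases w umax rule: linorder_cases) auto
      then have "p \<in> insert (umax, 0) ((\<lambda>x. (u x, e (u x))) ` {0..<l})"
      proof cases
        case 1
        then show ?thesis using w umax wF by simp
      next
        case 2
        then have "F = e w" using w u0 by (intro e_unique) auto
        moreover obtain x where "x \<in> {0..<l}" "w = u x"
          using im w 2 by (metis atLeastLessThan_iff imageE)
        ultimately show ?thesis using wF by auto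
      qed
      then show ?thesis using p by auto
    qed
  qed
  obtain c where c: "c \<in> {0..<l}" "u c = us"
    using im u0 us_in by (metis atLeastLessThan_iff greaterThanLessThan_iff imageE less_imp_le)
  have less: "u x < u y \<longleftrightarrow> x < y" if "x \<in> {0..<l}" "y \<in> {0..<l}" for x y
    using strict_mono_on_less[OF mono] that by blast
  have cross: "sonic_crossing us l u x \<longleftrightarrow> x = c" for x
  proof
    assume "sonic_crossing us l u x"
    then show "x = c"
      using less[of x c] less[of c x] c by (auto simp: sonic_crossing_def)
  next
    assume x: "x = c"
    have "c \<noteq> 0" using c u_0 u0 by auto
    then show "sonic_crossing us l u x"
      using c x less[of _ c] less[of c] by (auto simp: sonic_crossing_def)
  qed
  have uniq: "\<forall>v F. smooth_solution \<gamma> J us (J / uI) u0 (e u0) l v F \<longrightarrow>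
      (\<forall>x\<in>{0..<l}. v x = u x \<and> F x = e (u x))"
    using uniqueness[OF G uG Gu uI' du u_0 u0(2)] by blast
  have du': "\<forall>x\<in>{0..<l}. (u has_real_derivative V (u x)) (at x within {0..<l})"
    using du has_field_derivative_at_within by blast
  have V_pos': "\<forall>x\<in>{0..<l}. V (u x) > 0"
    using V_pos uI' by blast
  have limits: "\<exists>ul El. (u \<longlongrightarrow> ul) (at_left l) \<and> ((\<lambda>x. e (u x)) \<longlongrightarrow> El) (at_left l) \<and>
      T_acc \<gamma> J us uI \<inter> insert (ul, El) ((\<lambda>x. (u x, e (u x))) ` {0..<l}) =
      T_acc \<gamma> J us uI \<inter> {(w, G). w \<ge> u0}"
    by (rule exI[of _ umax], rule exI[of _ 0], intro conjI lim lim_e T)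
  have "accelerates \<gamma> J us (J / uI) uI u0 (e u0) l c"
    unfolding accelerates_def
    by (rule conjI[OF l], rule exI[of _ u], rule exI[of _ "\<lambda>x. e (u x)"], rule exI[of _ "\<lambda>x. V (u x)"])
      (use sol uniq du' V_pos' lim_V limits cross in \<open>intro conjI; blast\<close>)
  \<comment> \<open>The initial field is determined by \<open>u0\<close>, which removes the
    dependence of \<open>l\<close> and \<open>c\<close> on \<open>E0\<close>.\<close>
  moreover have "E0 = e u0" if "(u0, E0) \<in> T_acc \<gamma> J us uI" for E0
    using that by (intro e_unique[OF u0I]) (auto simp: T_acc_def)
  ultimately have "accelerates \<gamma> J us (J / uI) uI u0 E0 l c" if "(u0, E0) \<in> T_acc \<gamma> J us uI" for E0
    using that by metis
  then show ?thesis by blast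
qed

theorem lemma3p1:
  shows "\<exists>lmax ls :: real \<Rightarrow> real \<Rightarrow> real \<Rightarrow> real \<Rightarrow> real \<Rightarrow> real.
    \<forall>\<gamma> J S\<^sub>0 \<rho>\<^sub>I u\<^sub>I u\<^sub>s u\<^sub>0 E\<^sub>0 :: real.
      \<gamma> > 1 \<longrightarrow> J > 0 \<longrightarrow> S\<^sub>0 > 0 \<longrightarrow> \<rho>\<^sub>I > 0 \<longrightarrow>
      u\<^sub>I = J / \<rho>\<^sub>I \<longrightarrow> u\<^sub>s = sonic_speed \<gamma> J S\<^sub>0 \<longrightarrow> u\<^sub>I / u\<^sub>s > 1 \<longrightarrow>
      (u\<^sub>0, E\<^sub>0) \<in> T_acc \<gamma> J u\<^sub>s u\<^sub>I \<longrightarrow> u\<^sub>0 < u\<^sub>s \<longrightarrow>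
      (let l = lmax \<gamma> J S\<^sub>0 u\<^sub>I u\<^sub>0; c = ls \<gamma> J S\<^sub>0 u\<^sub>I u\<^sub>0 in
        l > 0 \<and>
        (\<exists>u E u' :: real \<Rightarrow> real.
           smooth_solution \<gamma> J u\<^sub>s \<rho>\<^sub>I u\<^sub>0 E\<^sub>0 l u E \<and>
           (\<forall>v F. smooth_solution \<gamma> J u\<^sub>s \<rho>\<^sub>I u\<^sub>0 E\<^sub>0 l v F \<longrightarrow>
              (\<forall>x\<in>{0..<l}. v x = u x \<and> F x = E x)) \<and>
           (\<forall>x\<in>{0..<l}. (u has_real_derivative u' x) (at x within {0..<l})) \<and>
           (\<forall>x\<in>{0..<l}. u' x > 0) \<and>
           (u' \<longlongrightarrow> 0) (at_left l) \<and>
           (\<exists>u\<^sub>l E\<^sub>l. (u \<longlongrightarrow> u\<^sub>l) (at_left l) \<and> (E \<longlongrightarrow> E\<^sub>l) (at_left l) \<and>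
              T_acc \<gamma> J u\<^sub>s u\<^sub>I \<inter> insert (u\<^sub>l, E\<^sub>l) ((\<lambda>x. (u x, E x)) ` {0..<l}) =
              T_acc \<gamma> J u\<^sub>s u\<^sub>I \<inter> {(w, G). w \<ge> u\<^sub>0}) \<and>
           (\<forall>x. sonic_crossing u\<^sub>s l u x \<longleftrightarrow> x = c)))"
proof -
  \<comment> \<open>One choice serves all admissible \<open>E0\<close>. The density is replaced by
    \<open>J / uI\<close>, and \<open>S\<^sub>0\<close> will enter only through the sonic speed, so
    the chosen pair depends on the listed parameters alone.\<close>
  define f where "f \<gamma> J us uI u0 =
    (SOME p. \<forall>E0. (u0, E0) \<in> T_acc \<gamma> J us uI \<longrightarrow>
      accelerates \<gamma> J us (J / uI) uI u0 E0 (fst p) (snd p))" for \<gamma> J us uI u0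
  have main: "accelerates \<gamma> J us \<rho> uI u0 E0 (fst (f \<gamma> J us uI u0)) (snd (f \<gamma> J us uI u0))"
    if "\<gamma> > 1" "J > 0" "S > 0" "\<rho> > 0" and uI_def: "uI = J / \<rho>" and us_def: "us = sonic_speed \<gamma> J S"
      and "uI / us > 1" and T: "(u0, E0) \<in> T_acc \<gamma> J us uI" and "u0 < us" for \<gamma> J S \<rho> uI us u0 E0
  proof -
    have us: "us > 0" unfolding us_def sonic_speed_def using that by simp
    interpret accelerating_flow \<gamma> J us uI
      by standard (use \<open>\<gamma> > 1\<close> \<open>J > 0\<close> us \<open>uI / us > 1\<close> in \<open>auto simp: less_divide_eq\<close>)
    have "u0 > 0" using T by (simp add: T_acc_def)
    then have "\<exists>p. \<forall>E0. (u0, E0) \<in> T_acc \<gamma> J us uI \<longrightarrow>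
        accelerates \<gamma> J us (J / uI) uI u0 E0 (fst p) (snd p)"
      using ex_accelerates[of u0] \<open>u0 < us\<close> by simp
    from someI_ex[OF this] T
    have "accelerates \<gamma> J us (J / uI) uI u0 E0 (fst (f \<gamma> J us uI u0)) (snd (f \<gamma> J us uI u0))"
      unfolding f_def by blast
    moreover have "J / uI = \<rho>" using \<open>J > 0\<close> uI_def by simp
    ultimately show ?thesis by simp
  qed
  show ?thesis
  proof (rule exI[of _ "\<lambda>\<gamma> J S uI u0. fst (f \<gamma> J (sonic_speed \<gamma> J S) uI u0)"],
      rule exI[of _ "\<lambda>\<gamma> J S uI u0. snd (f \<gamma> J (sonic_speed \<gamma> J S) uI u0)"],
      intro allI impI, goal_cases)
    case (1 \<gamma> J S\<^sub>0 \<rho>\<^sub>I u\<^sub>I u\<^sub>s u\<^sub>0 E\<^sub>0)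
    from main[OF this] show ?case
      unfolding accelerates_def Let_def 1(6) .
  qed
qed

end
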